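(* Let $3\le k\le n-1$ and let $M_1(k)$ be the complex $n$-dimensional Leibniz algebra with basis $\{y_1,\dots,y_n\}$ and products $[y_i,y_1]=y_{i+1}$ for $1\le i\le n-2$, $[y_i,y_n]=y_{k+i-1}$ for $1\le i\le n-k$, all other products of basis elements being zero. Define linear maps on $M_1(k)$ as follows (a map is zero on every basis vector on which no value is specified): $d_0(y_i)=i\,y_i$ for $1\le i\le n-1$, and $d_0(y_n)=(k-1)y_n$; $d_j(y_i)=y_{i+j}$ for $1\le i\le n-j-1$, for each $1\le j\le n-2$; $h_1(y_n)=y_{n-1}$; $h_2(y_1)=y_n$, and $h_2(y_i)=(i-1)y_{k+i-2}$ for $2\le i\le n-k+1$. Then: (a) if $2k-2\le n-1$, the maps $d_0,d_1,\dots,d_{n-2},h_1$ form a basis of the space $Der(M_1(k))$; (b) if $2k-2\ge n$, the maps $d_0,d_1,\dots,d_{n-2},h_1,h_2$ form a basis of the space $Der(M_1(k))$.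
   Context: A Leibniz algebra is a vector space $L$ with a bilinear product satisfying $[x,[y,z]]=[[x,y],z]-[[x,z],y]$. A derivation of $L$ is a linear map $d:L\to L$ with $d([x,y])=[d(x),y]+[x,d(y)]$ for all $x,y\in L$; $Der(L)$ denotes the vector space of all derivations of $L$. *)

theory Defs
  imports Complex_Main "HOL-Library.Function_Algebras"
begin

section \<open>Bases given by finite families\<close>

text \<open>
  A finite family of vectors, given as a list, is a basis of the subspace \<open>W\<close>.
  Distinctness is needed because the set of members does not record repetitions.
\<close>

definition list_basis ::
    "('a::field \<Rightarrow> 'v::ab_group_add \<Rightarrow> 'v) \<Rightarrow> 'v list \<Rightarrow> 'v set \<Rightarrow> bool"
  where "list_basis scale vs W \<longleftrightarrow>
    distinct vs \<and> \<not> module.dependent scale (set vs) \<and> module.span scale (set vs) = W"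

text \<open>
  Scalar multiplication of maps; addition of maps is the pointwise one of
  \<^theory>\<open>HOL-Library.Function_Algebras\<close>.
\<close>

definition fun_scale :: "('a \<Rightarrow> 'v \<Rightarrow> 'v) \<Rightarrow> 'a \<Rightarrow> ('u \<Rightarrow> 'v) \<Rightarrow> 'u \<Rightarrow> 'v"
  where "fun_scale scale c f = (\<lambda>x. scale c (f x))"


section \<open>Leibniz algebras and their derivations\<close>

locale leibniz_algebra = vector_space scale
  for scale :: "'a::field \<Rightarrow> 'v::ab_group_add \<Rightarrow> 'v" +
  fixes br :: "'v \<Rightarrow> 'v \<Rightarrow> 'v"
  assumes br_linear_left: "\<And>y. Vector_Spaces.linear scale scale (\<lambda>x. br x y)"
    and br_linear_right: "\<And>x. Vector_Spaces.linear scale scale (br x)"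
    and leibniz_identity: "\<And>x y z. br x (br y z) = br (br x y) z - br (br x z) y"

definition Der ::
    "('a::field \<Rightarrow> 'v::ab_group_add \<Rightarrow> 'v) \<Rightarrow> ('v \<Rightarrow> 'v \<Rightarrow> 'v) \<Rightarrow> ('v \<Rightarrow> 'v) set"
  where "Der scale br =
    {d. Vector_Spaces.linear scale scale d \<and> (\<forall>x y. d (br x y) = br (d x) y + br x (d y))}"


section \<open>The algebra \<open>M\<^sub>1(k)\<close>\<close>

definition M1_table :: "nat \<Rightarrow> nat \<Rightarrow> (nat \<Rightarrow> 'v::zero) \<Rightarrow> nat \<Rightarrow> nat \<Rightarrow> 'v"
  where "M1_table n k y i j =
    (if j = 1 \<and> 1 \<le> i \<and> i \<le> n - 2 then y (i + 1)
     else if j = n \<and> 1 \<le> i \<and> i \<le> n - k then y (k + i - 1)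
     else 0)"

locale M1_algebra = leibniz_algebra scale br
  for scale :: "complex \<Rightarrow> 'v::ab_group_add \<Rightarrow> 'v" and br :: "'v \<Rightarrow> 'v \<Rightarrow> 'v" +
  fixes n k :: nat and y :: "nat \<Rightarrow> 'v"
  assumes y_basis: "list_basis scale (map y [1..<n + 1]) UNIV"
    and br_y: "\<And>i j. i \<in> {1..n} \<Longrightarrow> j \<in> {1..n} \<Longrightarrow> br (y i) (y j) = M1_table n k y i j"


section \<open>The maps on \<open>M\<^sub>1(k)\<close>\<close>

text \<open>The linear map sending the basis vector \<open>y i\<close> to \<open>f i\<close> for \<open>1 \<le> i \<le> n\<close>.\<close>

definition lin_ext ::
    "('a::field \<Rightarrow> 'v::ab_group_add \<Rightarrow> 'v) \<Rightarrow> nat \<Rightarrow> (nat \<Rightarrow> 'v) \<Rightarrow> (nat \<Rightarrow> 'v) \<Rightarrow> 'v \<Rightarrow> 'v"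
  where "lin_ext scale n y f v =
    (\<Sum>i = 1..n. scale (module.representation scale (y ` {1..n}) v (y i)) (f i))"

definition d0_map ::
    "(complex \<Rightarrow> 'v::ab_group_add \<Rightarrow> 'v) \<Rightarrow> nat \<Rightarrow> nat \<Rightarrow> (nat \<Rightarrow> 'v) \<Rightarrow> 'v \<Rightarrow> 'v"
  where "d0_map scale n k y = lin_ext scale n y
    (\<lambda>i. if 1 \<le> i \<and> i \<le> n - 1 then scale (of_nat i) (y i)
         else if i = n then scale (of_nat (k - 1)) (y n)
         else 0)"

definition d_map ::
    "(complex \<Rightarrow> 'v::ab_group_add \<Rightarrow> 'v) \<Rightarrow> nat \<Rightarrow> (nat \<Rightarrow> 'v) \<Rightarrow> nat \<Rightarrow> 'v \<Rightarrow> 'v"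
  where "d_map scale n y j = lin_ext scale n y
    (\<lambda>i. if 1 \<le> i \<and> i \<le> n - j - 1 then y (i + j) else 0)"

definition h1_map ::
    "(complex \<Rightarrow> 'v::ab_group_add \<Rightarrow> 'v) \<Rightarrow> nat \<Rightarrow> (nat \<Rightarrow> 'v) \<Rightarrow> 'v \<Rightarrow> 'v"
  where "h1_map scale n y = lin_ext scale n y (\<lambda>i. if i = n then y (n - 1) else 0)"

definition h2_map ::
    "(complex \<Rightarrow> 'v::ab_group_add \<Rightarrow> 'v) \<Rightarrow> nat \<Rightarrow> nat \<Rightarrow> (nat \<Rightarrow> 'v) \<Rightarrow> 'v \<Rightarrow> 'v"
  where "h2_map scale n k y = lin_ext scale n y
    (\<lambda>i. if i = 1 then y n
         else if 2 \<le> i \<and> i \<le> n - k + 1 then scale (of_nat (i - 1)) (y (k + i - 2))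
         else 0)"


section \<open>Sanity checks\<close>

lemma set_basis_list: "set (map y [1..<n + 1]) = y ` {1..n::nat}"
  by (metis Suc_eq_plus1 atLeastLessThanSuc_atLeastAtMost set_map set_upt)

lemma (in vector_space) vector_space_fun_scale: "vector_space (fun_scale scale)"
  by unfold_locales
    (simp_all add: fun_scale_def fun_eq_iff scale_right_distrib scale_left_distrib)

context vector_space
begin

lemma lin_ext_linear:
  assumes "list_basis scale (map y [1..<n + 1]) UNIV"
  shows "Vector_Spaces.linear scale scale (lin_ext scale n y f)"
proof -
  have "independent (y ` {1..n})" "span (y ` {1..n}) = UNIV"
    using assms unfolding list_basis_def set_basis_list by auto
  then show ?thesis
    by unfold_locales
      (simp_all add: lin_ext_def representation_add representation_scale
        scale_left_distrib sum.distrib scale_sum_right)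
qed

lemma lin_ext_basis:
  assumes "list_basis scale (map y [1..<n + 1]) UNIV" "j \<in> {1..n}"
  shows "lin_ext scale n y f (y j) = f j"
proof -
  have ind: "independent (y ` {1..n})"
    using assms(1) unfolding list_basis_def set_basis_list by auto
  have inj: "inj_on y {1..n}"
    using assms(1)
    by (metis Suc_eq_plus1 atLeastLessThanSuc_atLeastAtMost distinct_map list_basis_def set_upt)
  have "lin_ext scale n y f (y j) = (\<Sum>i = 1..n. scale (if i = j then 1 else 0) (f i))"
    unfolding lin_ext_def
  proof (rule sum.cong)
    fix i assume "i \<in> {1..n}"
    then show "scale (representation (y ` {1..n}) (y j) (y i)) (f i)
        = scale (if i = j then 1 else 0) (f i)"
      using representation_basis[OF ind, of "y j"] assms(2) inj_on_eq_iff[OF inj, of j i] by auto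
  qed simp
  also have "\<dots> = (\<Sum>i = 1..n. if i = j then f i else 0)"
    by (rule sum.cong) auto
  also have "\<dots> = f j"
    using assms(2) by simp
  finally show ?thesis .
qed

end

end

theory Submission
  imports Defs
begin

text \<open>
  Let \<open>N\<close> be right multiplication by \<open>y 1\<close>. It shifts the chain \<open>y 1, \<dots>, y (n - 1)\<close> by one
  step and annihilates \<open>y n\<close>; right multiplication by \<open>y n\<close> is the power \<open>N\<^sup>k\<^sup>-\<^sup>1\<close>, and right
  multiplication by any other basis vector vanishes. If \<open>d\<close> is a derivation and \<open>a\<^sub>1\<close>, \<open>a\<^sub>n\<close> are the
  coordinates of \<open>d (y 1)\<close> at \<open>y 1\<close> and \<open>y n\<close>, the derivation rule for products with \<open>y 1\<close> says
  \<open>d N = N d + a\<^sub>1 N + a\<^sub>n N\<^sup>k\<^sup>-\<^sup>1\<close>. So \<open>d (y 1)\<close> determines \<open>d\<close> on the chain, and applying the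
  equation to \<open>y n\<close> gives \<open>N (d (y n)) = 0\<close>, which leaves \<open>d (y n)\<close> only its coordinates at
  \<open>y (n - 1)\<close> and \<open>y n\<close>. The derivation rule for \<open>[y 1, y n] = y k\<close> ties the latter to
  \<open>(k - 1) a\<^sub>1\<close> and leaves an extra term \<open>(k - 1) a\<^sub>n y (2 k - 2)\<close>. This term is nonzero precisely
  when \<open>2 k - 2 \<le> n - 1\<close> and \<open>a\<^sub>n \<noteq> 0\<close>, so in that range \<open>a\<^sub>n\<close> must vanish, and otherwise it is
  free. This is where \<open>h2\<close> enters or leaves the basis.

  Hence a derivation is determined by the coordinates of \<open>d (y 1)\<close> (the one at \<open>y n\<close> only if
  \<open>2 k - 2 \<ge> n\<close>) together with the coordinate of \<open>d (y n)\<close> at \<open>y (n - 1)\<close>. On the listed maps these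
  functionals take the values of the identity matrix, because \<open>d0\<close>, \<open>d j\<close>, \<open>h1\<close>, \<open>h2\<close> send \<open>y 1\<close>
  to \<open>y 1\<close>, \<open>y (1 + j)\<close>, \<open>0\<close>, \<open>y n\<close>, and only \<open>h1\<close> reaches \<open>y (n - 1)\<close> from \<open>y n\<close>. So the
  criterion \<open>list_basis_dual\<close> gives distinctness, independence and spanning in one stroke, once
  the maps are known to be derivations.
\<close>

section \<open>Recognising a basis by dual functionals\<close>

text \<open>
  The functionals \<open>\<phi> p\<close> read off the coefficients of a combination of the \<open>e q\<close>, which gives
  independence; subtracting from \<open>w\<close> the combination with coefficients \<open>\<phi> q w\<close> leaves a vector of
  \<open>W\<close> on which all functionals vanish, so separation gives spanning.
\<close>

lemma (in vector_space) list_basis_dual: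
  assumes W: "subspace W"
    and eW: "\<And>p. p < m \<Longrightarrow> e p \<in> W"
    and add: "\<And>p v w. p < m \<Longrightarrow> \<phi> p (v + w) = \<phi> p v + \<phi> p w"
    and hom: "\<And>p a v. p < m \<Longrightarrow> \<phi> p (scale a v) = a * \<phi> p v"
    and dual: "\<And>p q. p < m \<Longrightarrow> q < m \<Longrightarrow> \<phi> p (e q) = (if p = q then 1 else 0)"
    and sep: "\<And>w. w \<in> W \<Longrightarrow> (\<And>p. p < m \<Longrightarrow> \<phi> p w = 0) \<Longrightarrow> w = 0"
  shows "list_basis scale (map e [0..<m]) W"
proof -
  have zero: "\<phi> p 0 = 0" if "p < m" for p
    using hom[OF that, of 0 0] by simp
  have comb: "\<phi> p (\<Sum>q\<in>A. scale (a q) (e q)) = (if p \<in> A then a p else 0)"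
    if p: "p < m" and A: "A \<subseteq> {..<m}" for p a A
  proof -
    have fin: "finite A" using A finite_subset by blast
    then have "\<phi> p (\<Sum>q\<in>A. scale (a q) (e q)) = (\<Sum>q\<in>A. \<phi> p (scale (a q) (e q)))"
      by (induction A rule: finite_induct) (simp_all add: zero[OF p] add[OF p])
    also have "\<dots> = (\<Sum>q\<in>A. if p = q then a q else 0)"
      using A by (intro sum.cong) (auto simp: hom[OF p] dual[OF p])
    finally show ?thesis using fin by simp
  qed
  have inj: "inj_on e {..<m}"
    using dual by (intro inj_onI) (metis lessThan_iff one_neq_zero)
  have set_eq: "set (map e [0..<m]) = e ` {..<m}"
    by (auto simp: atLeast0LessThan)
  have "independent (e ` {..<m})"
  proof (rule independent_if_scalars_zero)
    fix g x assume g: "(\<Sum>x\<in>e ` {..<m}. scale (g x) x) = 0" and "x \<in> e ` {..<m}"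
    then obtain p where p: "p < m" "x = e p" by auto
    have "(\<Sum>q\<in>{..<m}. scale (g (e q)) (e q)) = 0"
      using g by (simp add: sum.reindex[OF inj])
    then show "g x = 0"
      using comb[OF p(1), of "{..<m}" "\<lambda>q. g (e q)"] p zero by simp
  qed simp
  moreover have "span (e ` {..<m}) = W"
  proof
    show "span (e ` {..<m}) \<subseteq> W" using eW W by (intro span_minimal) auto
    show "W \<subseteq> span (e ` {..<m})"
    proof
      fix w assume w: "w \<in> W"
      define u where "u = (\<Sum>q\<in>{..<m}. scale (\<phi> q w) (e q))"
      have u: "u \<in> span (e ` {..<m})" "u \<in> W"
        unfolding u_def using eW W
        by (auto intro!: span_sum span_scale subspace_sum subspace_scale intro: span_base)
      have "w - u = 0"
      proof (rule sep)
        show "w - u \<in> W" using w u W by (simp add: subspace_diff)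
        fix p assume p: "p < m"
        have "\<phi> p w = \<phi> p (w - u) + \<phi> p u" using add[OF p, of "w - u" u] by simp
        then show "\<phi> p (w - u) = 0"
          using comb[OF p, of "{..<m}" "\<lambda>q. \<phi> q w"] p by (simp add: u_def)
      qed
      then show "w \<in> span (e ` {..<m})" using u by simp
    qed
  qed
  ultimately show ?thesis
    using inj by (simp add: list_basis_def set_eq distinct_map lessThan_atLeast0)
qed

section \<open>Coordinates and products\<close>

(* The index 1 of the generator stays in the form in which the structure constants mention it. *)
declare One_nat_def [simp del]

lemma (in leibniz_algebra) br_simps [simp]:
  "br (u + v) w = br u w + br v w" "br w (u + v) = br w u + br w v"
  "br (scale a u) w = scale a (br u w)" "br w (scale a u) = scale a (br w u)"
  "br 0 w = 0" "br w 0 = 0"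
proof -
  interpret L: Vector_Spaces.linear scale scale "\<lambda>x. br x w" by (rule br_linear_left)
  interpret R: Vector_Spaces.linear scale scale "br w" by (rule br_linear_right)
  show "br (u + v) w = br u w + br v w" "br w (u + v) = br w u + br w v"
    "br (scale a u) w = scale a (br u w)" "br w (scale a u) = scale a (br w u)"
    "br 0 w = 0" "br w 0 = 0"
    by (simp_all add: L.add R.add L.scale R.scale L.zero R.zero)
qed

lemma (in leibniz_algebra) br_sum:
  "br (\<Sum>i\<in>A. f i) w = (\<Sum>i\<in>A. br (f i) w)" "br w (\<Sum>i\<in>A. f i) = (\<Sum>i\<in>A. br w (f i))"
  by (induction A rule: infinite_finite_induct) simp_all

lemma (in leibniz_algebra) subspace_Der:
  "module.subspace (fun_scale scale) (Der scale br)"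
proof -
  interpret F: vector_space "fun_scale scale" by (rule vector_space_fun_scale)
  interpret vector_space_pair scale scale ..
  show ?thesis
    unfolding F.subspace_def Der_def
    by (auto simp: fun_scale_def linear_compose_add module_hom_zero
        linear_compose_scale_right plus_fun_def zero_fun_def scale_right_distrib)
qed

context M1_algebra
begin

definition coord :: "nat \<Rightarrow> 'v \<Rightarrow> complex"
  where "coord i v = representation (y ` {1..n}) v (y i)"

text \<open>
  Cutting the basis off by zero beyond index \<open>n - 1\<close> turns every product with \<open>y 1\<close> or \<open>y n\<close> into
  an index shift without side conditions at the end of the chain.
\<close>

definition chain :: "nat \<Rightarrow> 'v"
  where "chain i = (if 1 \<le> i \<and> i \<le> n - 1 then y i else 0)"

lemma independent_y: "independent (y ` {1..n})"
  and span_y: "span (y ` {1..n}) = UNIV"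
  using y_basis unfolding list_basis_def set_basis_list by auto

lemma inj_y: "inj_on y {1..n}"
  using y_basis
  by (metis Suc_eq_plus1 atLeastLessThanSuc_atLeastAtMost distinct_map list_basis_def set_upt)

lemma coord_add: "coord i (u + v) = coord i u + coord i v"
  and coord_scale: "coord i (scale a v) = a * coord i v"
  and coord_0: "coord i 0 = 0"
  using independent_y span_y
  by (simp_all add: coord_def representation_add representation_scale representation_zero)

lemma coord_sum: "coord i (\<Sum>j\<in>A. f j) = (\<Sum>j\<in>A. coord i (f j))"
  by (induction A rule: infinite_finite_induct) (simp_all add: coord_0 coord_add)

lemma coord_y:
  assumes "i \<in> {1..n}" "j \<in> {1..n}"
  shows "coord i (y j) = (if i = j then 1 else 0)"
  using representation_basis[OF independent_y, of "y j"] assms inj_on_eq_iff[OF inj_y, of j i]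
  by (auto simp: coord_def)

lemma coord_expansion: "v = (\<Sum>i = 1..n. scale (coord i v) (y i))"
proof -
  have "v = (\<Sum>b\<in>y ` {1..n}. scale (representation (y ` {1..n}) v b) b)"
    using sum_representation_eq[OF independent_y, of v "y ` {1..n}"] span_y by simp
  then show ?thesis by (simp add: sum.reindex[OF inj_y] coord_def del: One_nat_def)
qed

lemma eq_0_if_coords_0:
  assumes "\<And>i. i \<in> {1..n} \<Longrightarrow> coord i v = 0"
  shows "v = 0"
  using coord_expansion[of v] assms by simp

lemma linear_eq_0_if_0_on_y:
  assumes "Vector_Spaces.linear scale scale D" "\<And>i. i \<in> {1..n} \<Longrightarrow> D (y i) = 0"
  shows "D = 0"
proof
  interpret D: Vector_Spaces.linear scale scale D by fact
  fix v
  have "D v = D (\<Sum>i = 1..n. scale (coord i v) (y i))" using coord_expansion[of v] by simp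
  also have "\<dots> = 0" using assms(2) by (simp add: D.sum D.scale)
  finally show "D v = 0 v" by simp
qed

lemma Der_if_on_y:
  assumes "Vector_Spaces.linear scale scale D"
    and "\<And>i j. i \<in> {1..n} \<Longrightarrow> j \<in> {1..n} \<Longrightarrow>
      D (br (y i) (y j)) = br (D (y i)) (y j) + br (y i) (D (y j))"
  shows "D \<in> Der scale br"
proof -
  interpret D: Vector_Spaces.linear scale scale D by fact
  have "D (br u v) = br (D u) v + br u (D v)" for u v
  proof -
    define a where "a = (\<lambda>i. coord i u)"
    define b where "b = (\<lambda>i. coord i v)"
    have uv: "u = (\<Sum>i = 1..n. scale (a i) (y i))" "v = (\<Sum>i = 1..n. scale (b i) (y i))"
      unfolding a_def b_def by (rule coord_expansion)+
    have "D (br u v) = (\<Sum>i = 1..n. \<Sum>j = 1..n. scale (a i) (scale (b j) (D (br (y i) (y j)))))"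
      by (simp add: uv br_sum D.sum D.scale scale_sum_right)
        (subst sum.swap, simp add: mult.commute)
    also have "\<dots> = (\<Sum>i = 1..n. \<Sum>j = 1..n. scale (a i) (scale (b j) (br (D (y i)) (y j))))
        + (\<Sum>i = 1..n. \<Sum>j = 1..n. scale (a i) (scale (b j) (br (y i) (D (y j)))))"
      by (simp add: assms(2) scale_right_distrib sum.distrib)
    also have "(\<Sum>i = 1..n. \<Sum>j = 1..n. scale (a i) (scale (b j) (br (D (y i)) (y j)))) = br (D u) v"
      by (simp add: uv br_sum D.sum D.scale scale_sum_right)
        (subst sum.swap, simp add: mult.commute)
    also have "(\<Sum>i = 1..n. \<Sum>j = 1..n. scale (a i) (scale (b j) (br (y i) (D (y j))))) = br u (D v)"
      by (simp add: uv br_sum D.sum D.scale scale_sum_right)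
        (subst sum.swap, simp add: mult.commute)
    finally show ?thesis .
  qed
  then show ?thesis using assms(1) by (simp add: Der_def)
qed

context
  assumes k3: "3 \<le> k" and kn: "k \<le> n - 1"
begin

lemma y_in_chain: "1 \<le> i \<Longrightarrow> i \<le> n - 1 \<Longrightarrow> y i = chain i"
  by (simp add: chain_def)

lemma chain_0: "n \<le> i \<Longrightarrow> chain i = 0"
  using k3 kn by (auto simp: chain_def)

text \<open>
  For \<open>i \<ge> n\<close> both sides are zero. Index \<open>0\<close> is excluded: \<open>chain 0\<close> is zero while \<open>chain 1\<close> is not.
\<close>

lemma br_chain_y1: "1 \<le> i \<Longrightarrow> br (chain i) (y 1) = chain (i + 1)"
  using k3 kn by (auto simp: chain_def br_y M1_table_def)

lemma br_chain_yn: "1 \<le> i \<Longrightarrow> br (chain i) (y n) = chain (i + k - 1)"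
  using k3 kn by (auto simp: chain_def br_y M1_table_def add.commute)

lemma br_yn: "br (y n) v = 0"
proof -
  have "br (y n) v = (\<Sum>i = 1..n. scale (coord i v) (br (y n) (y i)))"
    by (subst coord_expansion[of v]) (simp add: br_sum)
  also have "\<dots> = 0"
    using k3 kn by (intro sum.neutral) (auto simp: br_y M1_table_def)
  finally show ?thesis .
qed

lemma br_chain_right_0:
  assumes "2 \<le> j"
  shows "br v (chain j) = 0"
proof -
  have "br v (chain j) = (\<Sum>i = 1..n. scale (coord i v) (br (y i) (chain j)))"
    by (subst coord_expansion[of v]) (simp add: br_sum)
  also have "\<dots> = 0"
    using k3 kn assms by (intro sum.neutral) (auto simp: chain_def br_y M1_table_def)
  finally show ?thesis .
qed

lemma y1_eq: "y 1 = chain 1"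
  using k3 kn by (simp add: chain_def)

text \<open>
  Only products with \<open>y 1\<close> or \<open>y n\<close> on the right are nonzero, which leaves four kinds of
  conditions: the derivation rule for these two right factors along the chain, and for the
  products that vanish because of their left factor \<open>y n\<close> or their right factor \<open>y j\<close>, the
  vanishing of the terms that \<open>D\<close> creates there.
\<close>

lemma Der_if_on_generators:
  assumes lin: "Vector_Spaces.linear scale scale D"
    and y1: "\<And>i. 1 \<le> i \<Longrightarrow> i \<le> n - 1 \<Longrightarrow>
      D (chain (i + 1)) = br (D (chain i)) (y 1) + br (chain i) (D (y 1))"
    and yn: "\<And>i. 1 \<le> i \<Longrightarrow> i \<le> n - 1 \<Longrightarrow>
      D (chain (i + k - 1)) = br (D (chain i)) (y n) + br (chain i) (D (y n))"
    and left: "\<And>v. br (D (y n)) v = 0"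
    and right: "\<And>v j. 2 \<le> j \<Longrightarrow> j \<le> n - 1 \<Longrightarrow> br v (D (chain j)) = 0"
  shows "D \<in> Der scale br"
proof (rule Der_if_on_y[OF lin])
  interpret D: Vector_Spaces.linear scale scale D by fact
  fix i j assume i: "i \<in> {1..n}" and j: "j \<in> {1..n}"
  show "D (br (y i) (y j)) = br (D (y i)) (y j) + br (y i) (D (y j))"
  proof (cases "i = n")
    case True
    then show ?thesis by (simp add: br_yn left D.zero)
  next
    case False
    then have yi: "y i = chain i" "1 \<le> i" "i \<le> n - 1" using i by (auto simp: chain_def)
    consider "j = 1" | "j = n" | "2 \<le> j" "j \<le> n - 1" using j by fastforce
    then show ?thesis
    proof cases
      case 1 then show ?thesis using y1[OF yi(2,3)] yi br_chain_y1[OF yi(2)] by metis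
    next
      case 2 then show ?thesis using yn[OF yi(2,3)] yi br_chain_yn[OF yi(2)] by metis
    next
      case 3
      then have "y j = chain j" by (simp add: chain_def)
      then show ?thesis using 3 right by (simp add: br_chain_right_0 D.zero)
    qed
  qed
qed

section \<open>The listed maps are derivations\<close>

lemma d0_map_values:
  "d0_map scale n k y (chain i) = scale (of_nat i) (chain i)"
  "d0_map scale n k y (y n) = scale (of_nat (k - 1)) (y n)"
  and linear_d0_map: "Vector_Spaces.linear scale scale (d0_map scale n k y)"
proof -
  show lin: "Vector_Spaces.linear scale scale (d0_map scale n k y)"
    unfolding d0_map_def by (rule lin_ext_linear[OF y_basis])
  then interpret D: Vector_Spaces.linear scale scale "d0_map scale n k y" .
  show "d0_map scale n k y (chain i) = scale (of_nat i) (chain i)"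
    using k3 kn D.zero
    by (auto simp: chain_def) (auto simp: d0_map_def lin_ext_basis[OF y_basis])
  show "d0_map scale n k y (y n) = scale (of_nat (k - 1)) (y n)"
    using k3 kn by (auto simp: d0_map_def lin_ext_basis[OF y_basis])
qed

lemma d_map_values:
  assumes "1 \<le> j"
  shows "1 \<le> i \<Longrightarrow> d_map scale n y j (chain i) = chain (i + j)"
    and "d_map scale n y j (y n) = 0"
    and "Vector_Spaces.linear scale scale (d_map scale n y j)"
proof -
  show lin: "Vector_Spaces.linear scale scale (d_map scale n y j)"
    unfolding d_map_def by (rule lin_ext_linear[OF y_basis])
  then interpret D: Vector_Spaces.linear scale scale "d_map scale n y j" .
  show "d_map scale n y j (chain i) = chain (i + j)" if "1 \<le> i"
    using k3 kn D.zero assms that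
    by (auto simp: chain_def) (auto simp: d_map_def lin_ext_basis[OF y_basis])
  show "d_map scale n y j (y n) = 0"
    using k3 kn assms by (auto simp: d_map_def lin_ext_basis[OF y_basis])
qed

lemma h1_map_values:
  "h1_map scale n y (chain i) = 0"
  "h1_map scale n y (y n) = chain (n - 1)"
  and linear_h1_map: "Vector_Spaces.linear scale scale (h1_map scale n y)"
proof -
  show lin: "Vector_Spaces.linear scale scale (h1_map scale n y)"
    unfolding h1_map_def by (rule lin_ext_linear[OF y_basis])
  then interpret D: Vector_Spaces.linear scale scale "h1_map scale n y" .
  show "h1_map scale n y (chain i) = 0"
    using k3 kn D.zero
    by (auto simp: chain_def) (auto simp: h1_map_def lin_ext_basis[OF y_basis])
  show "h1_map scale n y (y n) = chain (n - 1)"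
    using k3 kn by (auto simp: h1_map_def lin_ext_basis[OF y_basis] chain_def)
qed

lemma h2_map_values:
  "h2_map scale n k y (y 1) = y n"
  "2 \<le> i \<Longrightarrow> h2_map scale n k y (chain i) = scale (of_nat (i - 1)) (chain (k + i - 2))"
  "h2_map scale n k y (y n) = 0"
  and linear_h2_map: "Vector_Spaces.linear scale scale (h2_map scale n k y)"
proof -
  show lin: "Vector_Spaces.linear scale scale (h2_map scale n k y)"
    unfolding h2_map_def by (rule lin_ext_linear[OF y_basis])
  then interpret D: Vector_Spaces.linear scale scale "h2_map scale n k y" .
  show "h2_map scale n k y (chain i) = scale (of_nat (i - 1)) (chain (k + i - 2))" if "2 \<le> i"
    using k3 kn D.zero that
    by (auto simp: chain_def) (auto simp: h2_map_def lin_ext_basis[OF y_basis])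
  show "h2_map scale n k y (y n) = 0" "h2_map scale n k y (y 1) = y n"
    using k3 kn by (auto simp: h2_map_def lin_ext_basis[OF y_basis])
qed

text \<open>
  The map \<open>d0\<close> multiplies by a grading: \<open>y i\<close> has degree \<open>i\<close>, and \<open>y n\<close> has degree \<open>k - 1\<close>, the
  length of the shift that it induces.
\<close>

lemma d0_map_Der: "d0_map scale n k y \<in> Der scale br"
proof (rule Der_if_on_generators[OF linear_d0_map])
  fix i :: nat assume i: "1 \<le> i"
  show "d0_map scale n k y (chain (i + 1)) =
      br (d0_map scale n k y (chain i)) (y 1) + br (chain i) (d0_map scale n k y (y 1))"
    using i by (simp add: d0_map_values y1_eq scale_left_distrib)
      (simp add: br_chain_y1[unfolded y1_eq])
  show "d0_map scale n k y (chain (i + k - 1)) =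
      br (d0_map scale n k y (chain i)) (y n) + br (chain i) (d0_map scale n k y (y n))"
    using i k3 by (simp add: d0_map_values br_chain_yn of_nat_diff flip: scale_left_distrib)
qed (simp_all add: d0_map_values br_yn br_chain_right_0)

text \<open>
  On the chain, \<open>d_map\<close> is the \<open>j\<close>-th power of right multiplication by \<open>y 1\<close>. It commutes with both
  right multiplications, and its values lie in the part of the chain that acts by zero on the right.
\<close>

lemma d_map_Der:
  assumes j: "1 \<le> j"
  shows "d_map scale n y j \<in> Der scale br"
proof (rule Der_if_on_generators[OF d_map_values(3)[OF j]])
  fix i :: nat assume i: "1 \<le> i"
  have y1: "d_map scale n y j (y 1) = chain (1 + j)"
    using d_map_values(1)[OF j, of 1] by (simp add: y1_eq)
  show "d_map scale n y j (chain (i + 1)) =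
      br (d_map scale n y j (chain i)) (y 1) + br (chain i) (d_map scale n y j (y 1))"
    using i j br_chain_y1[of "i + j"] br_chain_right_0[of "1 + j"]
    by (simp add: d_map_values[OF j] y1 add_ac)
  show "d_map scale n y j (chain (i + k - 1)) =
      br (d_map scale n y j (chain i)) (y n) + br (chain i) (d_map scale n y j (y n))"
    using i j k3 by (simp add: d_map_values[OF j] br_chain_yn add.commute add.left_commute)
qed (use j in \<open>simp_all add: d_map_values br_chain_right_0\<close>)

lemma br_last_chain: "br (chain (n - 1)) v = 0"
proof -
  have "br (chain (n - 1)) v = (\<Sum>i = 1..n. scale (coord i v) (br (chain (n - 1)) (y i)))"
    by (subst coord_expansion[of v]) (simp add: br_sum)
  also have "\<dots> = 0"
    using k3 kn by (intro sum.neutral) (auto simp: chain_def br_y M1_table_def)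
  finally show ?thesis .
qed

lemma h1_map_Der: "h1_map scale n y \<in> Der scale br"
proof (rule Der_if_on_generators[OF linear_h1_map])
  fix i :: nat assume i: "1 \<le> i"
  show "h1_map scale n y (chain (i + k - 1)) =
      br (h1_map scale n y (chain i)) (y n) + br (chain i) (h1_map scale n y (y n))"
    using k3 kn by (simp add: h1_map_values br_chain_right_0)
qed (simp_all add: h1_map_values br_last_chain y1_eq)

text \<open>
  The bound on \<open>n\<close> is needed for \<open>[y 1, y n] = y k\<close>: since \<open>h2\<close> kills \<open>y n\<close> and
  \<open>[h2 (y 1), y n] = [y n, y n] = 0\<close>, the value \<open>h2 (y k) = (k - 1) y (2 k - 2)\<close> has to lie beyond
  the end of the chain.
\<close>

lemma h2_map_Der:
  assumes nk: "n \<le> 2 * k - 2"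
  shows "h2_map scale n k y \<in> Der scale br"
proof (rule Der_if_on_generators[OF linear_h2_map])
  fix i :: nat assume i: "1 \<le> i"
  show "h2_map scale n k y (chain (i + 1)) =
      br (h2_map scale n k y (chain i)) (y 1) + br (chain i) (h2_map scale n k y (y 1))"
  proof (cases "i = 1")
    case True
    then show ?thesis
      using k3 h2_map_values(1) br_chain_yn[of 1]
      by (simp add: h2_map_values br_yn flip: y1_eq)
  next
    case False
    then have i2: "2 \<le> i" using i by simp
    have h: "h2_map scale n k y (chain (i + 1)) = scale (of_nat i) (chain (i + k - 1))"
      using i2 k3 h2_map_values(2)[of "i + 1"] by (simp add: One_nat_def add.commute)
    have "br (h2_map scale n k y (chain i)) (y 1) = scale (of_nat (i - 1)) (chain (i + k - 1))"
      using i2 k3 br_chain_y1[of "k + i - 2"]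
      by (simp add: h2_map_values Suc_diff_Suc numeral_2_eq_2 One_nat_def add.commute)
    moreover have "br (chain i) (h2_map scale n k y (y 1)) = scale 1 (chain (i + k - 1))"
      using i by (simp add: h2_map_values br_chain_yn)
    ultimately show ?thesis
      using i unfolding h by (simp only: flip: scale_left_distrib) (simp add: of_nat_diff)
  qed
  show "h2_map scale n k y (chain (i + k - 1)) =
      br (h2_map scale n k y (chain i)) (y n) + br (chain i) (h2_map scale n k y (y n))"
  proof (cases "i = 1")
    case True
    then show ?thesis
      using k3 nk by (simp add: h2_map_values br_yn chain_0 flip: y1_eq)
  next
    case False
    then show ?thesis
      using i k3 nk by (simp add: h2_map_values br_chain_yn chain_0)
  qed
qed (use k3 in \<open>simp_all add: h2_map_values br_chain_right_0\<close>)

section \<open>A derivation is determined by few coordinates\<close>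

lemma coord_br_y1:
  assumes "1 \<le> i" "i \<le> n - 2"
  shows "coord (i + 1) (br v (y 1)) = coord i v"
proof -
  have "br v (y 1) = (\<Sum>j = 1..n. scale (coord j v) (br (y j) (y 1)))"
    by (subst coord_expansion[of v]) (simp add: br_sum)
  also have "coord (i + 1) \<dots> = (\<Sum>j = 1..n. coord j v * coord (i + 1) (br (y j) (y 1)))"
    by (simp add: coord_sum coord_scale)
  also have "\<dots> = (\<Sum>j = 1..n. if j = i then coord j v else 0)"
    using assms k3 kn by (intro sum.cong) (auto simp: br_y M1_table_def coord_y coord_0)
  also have "\<dots> = coord i v" using assms by auto
  finally show ?thesis .
qed

lemma br_y1_left: "br (y 1) v = scale (coord 1 v) (y 2) + scale (coord n v) (y k)"
proof -
  have "br (y 1) v = (\<Sum>j = 1..n. scale (coord j v) (br (y 1) (y j)))"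
    by (subst coord_expansion[of v]) (simp add: br_sum)
  also have "\<dots> = (\<Sum>j = 1..n. (if j = 1 then scale (coord 1 v) (y 2) else 0)
      + (if j = n then scale (coord n v) (y k) else 0))"
    using k3 kn by (intro sum.cong) (auto simp: br_y M1_table_def numeral_2_eq_2)
  also have "\<dots> = scale (coord 1 v) (y 2) + scale (coord n v) (y k)"
    using k3 kn by (auto simp: sum.distrib)
  finally show ?thesis .
qed

text \<open>
  Since \<open>y n\<close> multiplies to zero from the left, the rule for \<open>y (i + 1) = [y i, y 1]\<close> shifts
  \<open>D (y i)\<close> and adds \<open>a [y i, y n]\<close>; each step therefore contributes one more copy of the same
  shifted vector. With \<open>a = 1\<close> these are the values of \<open>h2\<close>, and with \<open>a = 0\<close> the lemma says that
  \<open>D\<close> vanishes on the chain.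
\<close>

lemma Der_y1_multiple_yn:
  assumes D: "D \<in> Der scale br" and D1: "D (y 1) = scale a (y n)"
  shows "2 \<le> i \<Longrightarrow> D (chain i) = scale (of_nat (i - 1) * a) (chain (k + i - 2))"
proof (induction i rule: nat_induct_at_least)
  case base
  have "D (chain 2) = D (br (chain 1) (y 1))" by (simp add: br_chain_y1 numeral_2_eq_2)
  also have "\<dots> = scale a (chain k)"
    using D D1 br_chain_yn[of 1] by (simp add: Der_def br_yn flip: y1_eq)
  finally show ?case by simp
next
  case (Suc i)
  have "D (chain (Suc i)) = D (br (chain i) (y 1))" using Suc by (simp add: br_chain_y1 flip: Suc_eq_plus1)
  also have "\<dots> = br (D (chain i)) (y 1) + br (chain i) (D (y 1))"
    using D by (simp add: Der_def)
  also have "\<dots> = scale (of_nat (i - 1) * a) (chain (k + i - 1)) + scale a (chain (k + i - 1))"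
  proof -
    have "k + i - 2 + 1 = k + i - 1" using Suc k3 by simp
    then show ?thesis
      using Suc k3 D1 br_chain_y1[of "k + i - 2"] br_chain_yn[of i] by (simp add: add.commute)
  qed
  also have "\<dots> = scale (of_nat (Suc i - 1) * a) (chain (k + Suc i - 2))"
    using Suc by (simp add: of_nat_diff algebra_simps flip: scale_left_distrib)
  finally show ?case .
qed

text \<open>
  As \<open>[y n, y 1] = 0\<close> and \<open>y n\<close> multiplies to zero from the left, \<open>[D (y n), y 1] = 0\<close>; the shift
  by \<open>y 1\<close> is injective on the span of \<open>y 1, \<dots>, y (n - 2)\<close>.
\<close>

lemma Der_yn_coords:
  assumes D: "D \<in> Der scale br" and i: "1 \<le> i" "i \<le> n - 2"
  shows "coord i (D (y n)) = 0"
proof -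
  interpret D: Vector_Spaces.linear scale scale D using D by (simp add: Der_def)
  have "D (br (y n) (y 1)) = br (D (y n)) (y 1) + br (y n) (D (y 1))"
    using D by (simp only: Der_def mem_Collect_eq)
  then have "br (D (y n)) (y 1) = D (br (y n) (y 1))" by (simp add: br_yn)
  also have "\<dots> = 0" by (simp add: br_yn D.zero)
  finally show ?thesis using coord_br_y1[OF i, of "D (y n)"] by (simp add: coord_0)
qed

text \<open>
  The left side is \<open>D (y k)\<close> computed along the chain, the right side is the same vector computed
  from \<open>y k = [y 1, y n]\<close>. Comparing coefficients forces \<open>a = 0\<close> if \<open>y (2 k - 2)\<close> is still in the
  chain, because \<open>2 k - 2 \<noteq> k\<close>, and forces the \<open>y n\<close>-coordinate of \<open>D (y n)\<close> to vanish if
  \<open>a = 0\<close>.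
\<close>

lemma Der_yk:
  assumes D: "D \<in> Der scale br" and D1: "D (y 1) = scale a (y n)"
  shows "scale (of_nat (k - 1) * a) (chain (2 * k - 2)) = scale (coord n (D (y n))) (chain k)"
proof -
  have "D (chain k) = D (br (y 1) (y n))" using br_chain_yn[of 1] by (simp add: y1_eq)
  also have "\<dots> = br (y 1) (D (y n))" using D D1 by (simp add: Der_def br_yn)
  also have "\<dots> = scale (coord n (D (y n))) (chain k)"
    using Der_yn_coords[OF D, of 1] k3 kn by (simp add: br_y1_left chain_def)
  finally show ?thesis using Der_y1_multiple_yn[OF D D1, of k] k3 by (simp add: mult_2)
qed

lemma Der_eq_0:
  assumes D: "D \<in> Der scale br" and D1: "D (y 1) = 0" and c: "coord (n - 1) (D (y n)) = 0"
  shows "D = 0"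
proof (rule linear_eq_0_if_0_on_y)
  show "Vector_Spaces.linear scale scale D" using D by (simp add: Der_def)
  have D1': "D (y 1) = scale 0 (y n)" using D1 by simp
  have "coord n (D (y n)) = 0"
    using arg_cong[OF Der_yk[OF D D1'], of "coord k"] k3 kn
    by (simp add: chain_def coord_scale coord_0 coord_y)
  then have "coord i (D (y n)) = 0" if "i \<in> {1..n}" for i
    using that c Der_yn_coords[OF D, of i] by (cases "i = n \<or> i = n - 1") auto
  then have Dn: "D (y n) = 0" by (rule eq_0_if_coords_0)
  fix i assume "i \<in> {1..n}"
  then consider "i = 1" | "i = n" | "2 \<le> i" "i \<le> n - 1" by fastforce
  then show "D (y i) = 0"
    using D1 Dn Der_y1_multiple_yn[OF D D1', of i] y_in_chain[of i] by cases auto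
qed

section \<open>The dual functionals\<close>

text \<open>
  The functionals are numbered by the positions in the two lists of the theorem, so that the same
  numbering serves both: position \<open>0\<close> is \<open>d0\<close>, position \<open>j \<le> n - 2\<close> is \<open>d j\<close>, and positions
  \<open>n - 1\<close> and \<open>n\<close> are \<open>h1\<close> and \<open>h2\<close>.
\<close>

definition dual_coord :: "nat \<Rightarrow> ('v \<Rightarrow> 'v) \<Rightarrow> complex"
  where "dual_coord p D =
    (if p = n - 1 then coord (n - 1) (D (y n))
     else if p = n then coord n (D (y 1))
     else coord (p + 1) (D (y 1)))"

definition der_basis :: "nat \<Rightarrow> 'v \<Rightarrow> 'v"
  where "der_basis p =
    (if p = 0 then d0_map scale n k y
     else if p = n - 1 then h1_map scale n y
     else if p = n then h2_map scale n k y
     else d_map scale n y p)"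

lemma dual_coord_der_basis:
  assumes "p \<le> n" "q \<le> n"
  shows "dual_coord p (der_basis q) = (if p = q then 1 else 0)"
proof -
  have d: "d_map scale n y q (y 1) = chain (1 + q)" if "1 \<le> q" for q
    using d_map_values(1)[OF that, of 1] by (simp add: y1_eq)
  have "d0_map scale n k y (y 1) = y 1" "h1_map scale n y (y 1) = 0"
    using d0_map_values(1)[of 1] h1_map_values(1)[of 1] by (simp_all add: y1_eq)
  then show ?thesis
    using assms k3 kn
    by (auto simp: dual_coord_def der_basis_def d0_map_values d_map_values h1_map_values
        h2_map_values d chain_def coord_y coord_scale coord_0)
qed

text \<open>
  If the functionals at the positions below \<open>n\<close> vanish on \<open>D\<close>, then \<open>D (y 1)\<close> is a multiple
  \<open>a y n\<close>. The scalar \<open>a\<close> vanishes by \<open>Der_yk\<close> in the first case, and in the second case because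
  it is the value of the additional functional; then \<open>Der_eq_0\<close> applies.
\<close>

lemma der_basis_list_basis:
  assumes m: "m = n \<and> 2 * k - 2 \<le> n - 1 \<or> m = n + 1 \<and> n \<le> 2 * k - 2"
  shows "list_basis (fun_scale scale) (map der_basis [0..<m]) (Der scale br)"
proof -
  interpret F: vector_space "fun_scale scale" by (rule vector_space_fun_scale)
  have mn: "n \<le> m" "m \<le> n + 1" using m by auto
  show ?thesis
  proof (rule F.list_basis_dual[where \<phi> = dual_coord])
    show "F.subspace (Der scale br)" by (rule subspace_Der)
    show "der_basis p \<in> Der scale br" if "p < m" for p
      using that m d0_map_Der d_map_Der[of p] h1_map_Der h2_map_Der
      by (auto simp: der_basis_def)
    show "dual_coord p (v + w) = dual_coord p v + dual_coord p w" for p v w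
      by (simp add: dual_coord_def coord_add)
    show "dual_coord p (fun_scale scale a v) = a * dual_coord p v" for p a v
      by (simp add: dual_coord_def coord_scale fun_scale_def)
    show "dual_coord p (der_basis q) = (if p = q then 1 else 0)" if "p < m" "q < m" for p q
      using dual_coord_der_basis that mn by simp
    fix D assume D: "D \<in> Der scale br" and 0: "\<And>p. p < m \<Longrightarrow> dual_coord p D = 0"
    have c: "coord (n - 1) (D (y n)) = 0"
      using 0[of "n - 1"] mn k3 kn by (simp add: dual_coord_def)
    have c1: "coord i (D (y 1)) = 0" if "i \<in> {1..n}" "i \<noteq> n" for i
    proof -
      from that have i: "i - 1 < m" "i - 1 \<noteq> n - 1" "i - 1 \<noteq> n" "i - 1 + 1 = i"
        using mn by auto
      show ?thesis using 0[OF i(1)] i(2-4) by (simp only: dual_coord_def if_False)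
    qed
    define a where "a = coord n (D (y 1))"
    have "D (y 1) = (\<Sum>i = 1..n. if i = n then scale a (y n) else 0)"
      by (subst coord_expansion[of "D (y 1)"], intro sum.cong) (auto simp: c1 a_def)
    then have D1: "D (y 1) = scale a (y n)" using k3 kn by auto
    have "a = 0"
    proof (cases "m = n")
      case True
      then have idx: "2 * k - 2 \<in> {1..n - 1}" "k \<in> {1..n - 1}" "2 * k - 2 \<noteq> k"
        using m k3 kn by auto
      then have "coord (2 * k - 2) (chain (2 * k - 2)) = 1" "coord (2 * k - 2) (chain k) = 0"
        by (auto simp: chain_def coord_y)
      then have "of_nat (k - 1) * a = 0"
        using arg_cong[OF Der_yk[OF D D1], of "coord (2 * k - 2)"] by (simp add: coord_scale)
      moreover have "k - 1 \<noteq> 0" using k3 by simp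
      ultimately show ?thesis by (metis mult_eq_0_iff of_nat_eq_0_iff)
    next
      case False
      then have "n < m" "n \<noteq> n - 1" using m kn k3 by auto
      then show ?thesis using 0[of n] by (simp add: dual_coord_def a_def)
    qed
    then show "D = 0" using Der_eq_0[OF D _ c] D1 by simp
  qed
qed

lemma map_der_basis:
  "map der_basis [0..<n] =
    [d0_map scale n k y] @ map (d_map scale n y) [1..<n - 1] @ [h1_map scale n y]"
  "map der_basis [0..<n + 1] =
    [d0_map scale n k y] @ map (d_map scale n y) [1..<n - 1] @ [h1_map scale n y, h2_map scale n k y]"
proof -
  have "[0..<n] = [0] @ [1..<n - 1] @ [n - 1]"
    using k3 kn upt_conv_Cons[of 0 n] upt_Suc_append[of 1 "n - 1"] by (simp add: One_nat_def)
  moreover have "map der_basis [1..<n - 1] = map (d_map scale n y) [1..<n - 1]"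
    by (auto simp: der_basis_def)
  ultimately show "map der_basis [0..<n] =
      [d0_map scale n k y] @ map (d_map scale n y) [1..<n - 1] @ [h1_map scale n y]"
    using k3 kn by (auto simp: der_basis_def)
  then show "map der_basis [0..<n + 1] =
    [d0_map scale n k y] @ map (d_map scale n y) [1..<n - 1] @ [h1_map scale n y, h2_map scale n k y]"
    using k3 kn by (auto simp: der_basis_def simp flip: Suc_eq_plus1)
qed

end

end

theorem proposition4p1:
  fixes scale :: "complex \<Rightarrow> 'v::ab_group_add \<Rightarrow> 'v"
    and br :: "'v \<Rightarrow> 'v \<Rightarrow> 'v"
    and y :: "nat \<Rightarrow> 'v"
    and n k :: nat
  assumes "3 \<le> k" and "k \<le> n - 1"
    and "M1_algebra scale br n k y"
  shows "(2 * k - 2 \<le> n - 1 \<longrightarrow>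
            list_basis (fun_scale scale)
              ([d0_map scale n k y] @ map (d_map scale n y) [1..<n - 1] @ [h1_map scale n y])
              (Der scale br)) \<and>
         (n \<le> 2 * k - 2 \<longrightarrow>
            list_basis (fun_scale scale)
              ([d0_map scale n k y] @ map (d_map scale n y) [1..<n - 1] @
                [h1_map scale n y, h2_map scale n k y])
              (Der scale br))"
proof -
  interpret M1_algebra scale br n k y by fact
  show ?thesis
    using der_basis_list_basis[OF assms(1,2), of n] der_basis_list_basis[OF assms(1,2), of "n + 1"]
    unfolding map_der_basis[OF assms(1,2)] by blast
qed

end
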